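(* Let $\mathcal H$ be a real Hilbert space, let $M_1,\ldots,M_m$ be closed linear subspaces of $\mathcal H$, let $M:=\bigcap_{i=1}^m M_i$ and $T:=P_{M_m}\cdots P_{M_1}$, and assume that $\sum_{i=1}^m M_i^\perp$ is not closed. For $p=1,2,\ldots$ let $X_p:=M\oplus(I-T)^p(\mathcal H)$, and let $Y:=M\oplus\sum_{i=1}^m M_i^\perp$. Then for every $p\in\{1,2,\ldots\}$ and every $\varepsilon>0$, the polynomial $k^p$ cannot be replaced by $k^{p+\varepsilon}$ in the rate "$\|T^k(y_0)-P_M(y_0)\|=o(k^{-p})$ for each $y_0\in X_p$"; that is, it is not true that $\|T^k(y_0)-P_M(y_0)\|=o(k^{-p-\varepsilon})$ as $k\to\infty$ for all $y_0\in X_p$. In particular, for every $p=1,2,\ldots$ the inclusions $X_{p+1}\subset X_p\subset Y$ are strict.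
   Context: For a closed linear subspace $L$ of $\mathcal H$, $P_L$ denotes the orthogonal projection onto $L$ and $L^\perp$ its orthogonal complement; $I$ is the identity operator. The sum $\sum_{i=1}^m M_i^\perp=\{x_1+\cdots+x_m: x_i\in M_i^\perp\}$ is algebraic (not closed up). The subspaces $(I-T)^p(\mathcal H)$ (the range of $(I-T)^p$) and $\sum_{i=1}^m M_i^\perp$ are orthogonal to $M$, and $\oplus$ denotes the (algebraic) sum with $M$. It is known (and is the rate referred to in the claim) that $\|T^k(y_0)-P_M(y_0)\|=o(k^{-p})$ for every $y_0\in X_p$. *)

theory Defs
  imports "HOL-Analysis.Analysis" "HOL-Library.Set_Algebras" "HOL-Library.Landau_Symbols"
begin

text \<open>
  A real Hilbert space is a type of sort \<open>{real_inner, complete_space}\<close>. The library's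
  \<open>closest_point\<close> requires \<open>heine_borel\<close>, i.e. finite dimension, so the orthogonal projection is
  defined here by the decomposition \<open>x = y + (x - y)\<close> with \<open>y \<in> L\<close> and \<open>x - y \<in> L\<^sup>\<bottom>\<close>;
  it is meaningful for closed subspaces \<open>L\<close>.
\<close>

definition orth_proj :: "'a::{real_inner, complete_space} set \<Rightarrow> 'a \<Rightarrow> 'a"
  where "orth_proj L x = (THE y. y \<in> L \<and> x - y \<in> L\<^sup>\<bottom>)"

text \<open>Families \<open>M\<^sub>1, \<dots>, M\<^sub>m\<close> are functions on \<open>nat\<close> of which only the indices \<open>1, \<dots>, m\<close> matter.\<close>

primrec cyclic_proj :: "(nat \<Rightarrow> 'a::{real_inner, complete_space} set) \<Rightarrow> nat \<Rightarrow> 'a \<Rightarrow> 'a"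
  where
    "cyclic_proj M 0 = id"
  | "cyclic_proj M (Suc n) = orth_proj (M (Suc n)) \<circ> cyclic_proj M n"

definition common_subspace :: "(nat \<Rightarrow> 'a set) \<Rightarrow> nat \<Rightarrow> 'a set"
  where "common_subspace M m = (\<Inter>i\<in>{1..m}. M i)"

text \<open>Sums of sets, binary and indexed, are the elementwise (Minkowski) sums of
  \<open>HOL-Library.Set_Algebras\<close>; no closure is taken.\<close>

definition sum_complements :: "(nat \<Rightarrow> 'a::real_inner set) \<Rightarrow> nat \<Rightarrow> 'a set"
  where "sum_complements M m = (\<Sum>i=1..m. (M i)\<^sup>\<bottom>)"

definition X_space :: "(nat \<Rightarrow> 'a::{real_inner, complete_space} set) \<Rightarrow> nat \<Rightarrow> nat \<Rightarrow> 'a set"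
  where "X_space M m p =
    common_subspace M m + range ((\<lambda>x. x - cyclic_proj M m x) ^^ p)"

definition Y_space :: "(nat \<Rightarrow> 'a::real_inner set) \<Rightarrow> nat \<Rightarrow> 'a set"
  where "Y_space M m = common_subspace M m + sum_complements M m"

end

theory Submission
  imports Defs
begin

text \<open>
  Write \<open>T\<close> for the product of the projections, \<open>S = I - T\<close>, \<open>M\<close> for the common subspace and \<open>E\<close> for
  the sum of the complements \<open>M\<^sub>i\<^sup>\<bottom>\<close>. One always has \<open>range S \<subseteq> E \<subseteq> M\<^sup>\<bottom>\<close>, and \<open>S\<close> is injective on
  \<open>M\<^sup>\<bottom>\<close> since the fixed points of \<open>T\<close> are exactly \<open>M\<close>. If \<open>S\<close> maps onto \<open>M\<^sup>\<bottom>\<close>, then \<open>E = M\<^sup>\<bottom>\<close> is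
  closed (\<open>sum_complements_closed_if_S_onto\<close>). So each claim is proved by showing that its failure
  makes \<open>S\<close> map onto \<open>M\<^sup>\<bottom>\<close>. By Banach's fixed point theorem this happens as soon as some power of
  \<open>T\<close> contracts \<open>M\<^sup>\<bottom>\<close> (\<open>S_onto_if_power_contracts\<close>).

  \<^item> If \<open>X\<^bsub>p+1\<^esub> = X\<^sub>p\<close>, then \<open>S\<^sup>p z \<in> range S\<^bsup>p+1\<^esup>\<close> for all \<open>z \<in> M\<^sup>\<bottom>\<close>, and injectivity cancels \<open>S\<^sup>p\<close>
    (\<open>S_onto_if_X_space_Suc_eq\<close>).

  \<^item> If \<open>|T\<^sup>k y - P\<^sub>M y| = o(k\<^bsup>-p-\<epsilon>\<^esup>)\<close> on \<open>X\<^sub>p\<close>, then \<open>|T\<^sup>k S\<^sup>p x| = O(k\<^bsup>-p-\<epsilon>\<^esup>)\<close> for every \<open>x \<in> M\<^sup>\<bottom>\<close>. Since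
    \<open>T\<^sup>k S z\<close> is the increment of the sequence \<open>T\<^sup>k z\<close>, summation trades one factor \<open>S\<close> for one power
    of \<open>k\<close>, so \<open>|T\<^sup>k x| = O(k\<^bsup>-\<epsilon>\<^esup>)\<close> for every such \<open>x\<close>. The uniform boundedness principle makes this
    uniform on the unit ball of \<open>M\<^sup>\<bottom>\<close>, where a high power of \<open>T\<close> is therefore a contraction
    (\<open>rate_of_S_pow_imp_rate\<close>, \<open>S_onto_if_pointwise_rate\<close>).

  \<^item> If \<open>X\<^sub>1 = Y\<close>, then \<open>range S = E\<close>. Let \<open>d x\<close> be the sum of the distances of \<open>x\<close> to the \<open>M\<^sub>i\<close>. As every
    vector of every \<open>M\<^sub>i\<^sup>\<bottom>\<close> lies in \<open>range S\<close>, uniform boundedness gives \<open>d x \<le> c |S\<^sup>* x|\<close>. On the other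
    hand the form \<open>(S x, z)\<close> is bounded by a multiple of \<open>d x d z\<close>. With \<open>y = S\<^sup>* x\<close> this yields
    \<open>|y|\<^sup>2 = (S y, x) \<le> c' d y d x \<le> c'' d y |y|\<close>, that is \<open>|y| \<le> c'' d y\<close> on \<open>range S\<^sup>*\<close>, which is
    dense in \<open>M\<^sup>\<bottom>\<close>. This linear regularity says that a unit vector of \<open>M\<^sup>\<bottom>\<close> is far from some \<open>M\<^sub>i\<close>, so
    one cycle loses a fixed proportion of its norm, and \<open>T\<close> itself is a contraction of \<open>M\<^sup>\<bottom>\<close>
    (\<open>S_onto_if_sum_complements_subset_range_S\<close>, \<open>S_onto_if_linearly_regular\<close>).

  The strictness of \<open>X\<^sub>p \<subset> Y\<close> for larger \<open>p\<close> follows from that of the chain.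
\<close>

section \<open>Orthogonal projections in Hilbert space\<close>

lemma inner_orthogonal_comp:
  assumes "x \<in> L\<^sup>\<bottom>" "y \<in> L"
  shows "inner x y = 0" "inner y x = 0"
  using assms by (auto simp: orthogonal_comp_def orthogonal_def inner_commute)

lemma orthogonal_compI:
  assumes "\<And>y. y \<in> L \<Longrightarrow> inner x y = 0"
  shows "x \<in> L\<^sup>\<bottom>"
  using assms by (auto simp: orthogonal_comp_def orthogonal_def inner_commute)

lemma mem_orthogonal_comp_self_eq_0:
  assumes "x \<in> L" "x \<in> L\<^sup>\<bottom>"
  shows "x = 0"
  using inner_orthogonal_comp(1)[OF assms(2,1)] by simp

lemma closed_orthogonal_comp: "closed (L\<^sup>\<bottom>)"
proof -
  have "L\<^sup>\<bottom> = (\<Inter>y\<in>L. {x. inner y x = 0})"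
    by (auto simp: orthogonal_comp_def orthogonal_def)
  moreover have "closed {x. inner y x = 0}" for y :: 'a
    by (intro closed_Collect_eq continuous_intros)
  ultimately show ?thesis by auto
qed

lemma subspace_closure:
  fixes L :: "'a::real_normed_vector set"
  assumes L: "subspace L"
  shows "subspace (closure L)"
proof (rule subspaceI)
  show "0 \<in> closure L" using subspace_0[OF L] closure_subset by blast
next
  fix x y assume "x \<in> closure L" "y \<in> closure L"
  then obtain f g where "\<And>n. f n \<in> L" "f \<longlonglongrightarrow> x" "\<And>n. g n \<in> L" "g \<longlonglongrightarrow> y"
    unfolding closure_sequential by metis
  then show "x + y \<in> closure L"
    unfolding closure_sequential
    by (intro exI[of _ "\<lambda>n. f n + g n"]) (auto intro: subspace_add[OF L] tendsto_add)
next
  fix c x assume "x \<in> closure L"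
  then obtain f where "\<And>n. f n \<in> L" "f \<longlonglongrightarrow> x"
    unfolding closure_sequential by metis
  then show "c *\<^sub>R x \<in> closure L"
    unfolding closure_sequential
    by (intro exI[of _ "\<lambda>n. c *\<^sub>R f n"]) (auto intro: subspace_scale[OF L] tendsto_intros)
qed

text \<open>A vector of \<open>L\<close> nearest to \<open>x\<close> is the foot of the perpendicular: moving from \<open>y\<close> in a
  direction \<open>z \<in> L\<close> by the optimal amount lowers the squared length of the residual by
  \<open>(x - y, z)\<^sup>2 / |z|\<^sup>2\<close>.\<close>

lemma nearest_imp_orthogonal:
  fixes L :: "'a::real_inner set"
  assumes L: "subspace L" and y: "y \<in> L" and le: "\<And>z. z \<in> L \<Longrightarrow> norm (x - y) \<le> norm (x - z)"
  shows "x - y \<in> L\<^sup>\<bottom>"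
proof (rule orthogonal_compI)
  fix z assume z: "z \<in> L"
  show "inner (x - y) z = 0"
  proof (cases "z = 0")
    case False
    define t where "t = inner (x - y) z / inner z z"
    have zz: "inner z z > 0" using False by simp
    have "y + t *\<^sub>R z \<in> L" by (intro subspace_add subspace_scale L y z)
    from le[OF this] have "(norm (x - y))\<^sup>2 \<le> (norm ((x - y) - t *\<^sub>R z))\<^sup>2"
      by (simp add: algebra_simps)
    also have "\<dots> = (norm (x - y))\<^sup>2 - 2 * t * inner (x - y) z + t\<^sup>2 * inner z z"
      unfolding power2_norm_eq_inner
      by (simp add: inner_diff_left inner_diff_right inner_commute power2_eq_square algebra_simps)
    also have "t * inner (x - y) z = t\<^sup>2 * inner z z"
      using zz by (simp add: t_def power2_eq_square)
    then have "2 * t * inner (x - y) z = 2 * (t\<^sup>2 * inner z z)" by simp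
    finally have "t\<^sup>2 * inner z z \<le> 0" by (simp add: mult.commute)
    with zz have "t = 0" by (metis mult_le_0_iff not_le power2_less_eq_zero_iff)
    then show ?thesis using zz by (simp add: t_def)
  qed simp
qed

text \<open>By the parallelogram law, a minimizing sequence for the distance from \<open>x\<close> to \<open>L\<close> is Cauchy,
  because the midpoint of two nearly optimal vectors cannot do better than the infimum.\<close>

lemma nearest_point_exists:
  fixes L :: "'a::{real_inner, complete_space} set"
  assumes L: "subspace L" and cl: "closed L"
  obtains y where "y \<in> L" "\<And>z. z \<in> L \<Longrightarrow> norm (x - y) \<le> norm (x - z)"
proof -
  define D where "D = Inf ((\<lambda>z. (norm (x - z))\<^sup>2) ` L)"
  have ne: "L \<noteq> {}" using subspace_0[OF L] by blast
  have bb: "bdd_below ((\<lambda>z. (norm (x - z))\<^sup>2) ` L)" by (rule bdd_belowI[of _ 0]) auto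
  have D_le: "D \<le> (norm (x - z))\<^sup>2" if "z \<in> L" for z
    unfolding D_def using bb that by (auto intro: cInf_lower)
  have "\<exists>y. y \<in> L \<and> (norm (x - y))\<^sup>2 < D + inverse (real (Suc n))" for n
  proof -
    have "Inf ((\<lambda>z. (norm (x - z))\<^sup>2) ` L) < D + inverse (real (Suc n))" by (simp add: D_def)
    then show ?thesis using cInf_lessD[of "(\<lambda>z. (norm (x - z))\<^sup>2) ` L"] ne by blast
  qed
  then obtain y where yL: "\<And>n. y n \<in> L"
    and yD: "\<And>n. (norm (x - y n))\<^sup>2 < D + inverse (real (Suc n))" by metis
  have diff: "(norm (y j - y k))\<^sup>2 \<le> 2 * inverse (real (Suc j)) + 2 * inverse (real (Suc k))"
    for j k
  proof -
    define w where "w = (1/2) *\<^sub>R (y j + y k)"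
    have "w \<in> L" unfolding w_def by (intro subspace_add subspace_scale L yL)
    then have "D \<le> (norm (x - w))\<^sup>2" by (rule D_le)
    moreover have "(norm (y j - y k))\<^sup>2
        = 2 * (norm (x - y j))\<^sup>2 + 2 * (norm (x - y k))\<^sup>2 - 4 * (norm (x - w))\<^sup>2"
      unfolding power2_norm_eq_inner w_def
      by (simp add: inner_diff_left inner_diff_right inner_add_left inner_add_right
          inner_commute algebra_simps)
    ultimately show ?thesis using yD[of j] yD[of k] by linarith
  qed
  have "Cauchy y"
  proof (rule metric_CauchyI)
    fix e :: real assume e: "e > 0"
    then obtain N where N: "inverse (real (Suc N)) < e\<^sup>2 / 4"
      using reals_Archimedean[of "e\<^sup>2 / 4"] by auto
    show "\<exists>N. \<forall>j\<ge>N. \<forall>k\<ge>N. dist (y j) (y k) < e"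
    proof (intro exI allI impI)
      fix j k assume jk: "j \<ge> N" "k \<ge> N"
      have "inverse (real (Suc j)) \<le> inverse (real (Suc N))"
        "inverse (real (Suc k)) \<le> inverse (real (Suc N))" using jk by (auto intro: le_imp_inverse_le)
      with diff[of j k] N have "(norm (y j - y k))\<^sup>2 < e\<^sup>2" by linarith
      then show "dist (y j) (y k) < e" using e by (simp add: dist_norm power2_less_imp_less)
    qed
  qed
  then obtain l where l: "y \<longlonglongrightarrow> l" using Cauchy_convergent convergentD by blast
  have lL: "l \<in> L" using closed_sequentially[OF cl] yL l by blast
  have "(\<lambda>n. (norm (x - y n))\<^sup>2) \<longlonglongrightarrow> (norm (x - l))\<^sup>2" by (intro tendsto_intros l)
  moreover have "(\<lambda>n. D + inverse (real (Suc n))) \<longlonglongrightarrow> D + 0"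
    by (intro tendsto_intros LIMSEQ_inverse_real_of_nat)
  moreover have "\<exists>N. \<forall>n\<ge>N. (norm (x - y n))\<^sup>2 \<le> D + inverse (real (Suc n))"
    using yD less_imp_le by blast
  ultimately have lD: "(norm (x - l))\<^sup>2 \<le> D + 0" by (rule LIMSEQ_le)
  have "norm (x - l) \<le> norm (x - z)" if z: "z \<in> L" for z
  proof (rule power2_le_imp_le)
    show "(norm (x - l))\<^sup>2 \<le> (norm (x - z))\<^sup>2" using D_le[OF z] lD by linarith
  qed simp
  with lL show ?thesis by (rule that)
qed

lemma orth_proj_eqI:
  fixes L :: "'a::{real_inner, complete_space} set"
  assumes L: "subspace L" and y: "y \<in> L" "x - y \<in> L\<^sup>\<bottom>"
  shows "orth_proj L x = y"
  unfolding orth_proj_def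
proof (rule the_equality)
  fix z assume z: "z \<in> L \<and> x - z \<in> L\<^sup>\<bottom>"
  have "z - y \<in> L" using L y z by (auto intro: subspace_diff)
  moreover have "(x - y) - (x - z) \<in> L\<^sup>\<bottom>"
    using subspace_diff[OF subspace_orthogonal_comp y(2)] z by blast
  then have "z - y \<in> L\<^sup>\<bottom>" by simp
  ultimately have "z - y = 0" by (rule mem_orthogonal_comp_self_eq_0)
  then show "z = y" by simp
qed (use y in auto)

context
  fixes L :: "'a::{real_inner, complete_space} set"
  assumes L: "subspace L" and cl: "closed L"
begin

lemma orth_proj_mem: "orth_proj L x \<in> L"
  and orth_proj_residual: "x - orth_proj L x \<in> L\<^sup>\<bottom>"
proof -
  obtain y where y: "y \<in> L" "\<And>z. z \<in> L \<Longrightarrow> norm (x - y) \<le> norm (x - z)"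
    using nearest_point_exists[OF L cl] by blast
  have res: "x - y \<in> L\<^sup>\<bottom>" using nearest_imp_orthogonal[OF L y] .
  show "orth_proj L x \<in> L" "x - orth_proj L x \<in> L\<^sup>\<bottom>"
    unfolding orth_proj_eqI[OF L y(1) res] using y(1) res by simp_all
qed

lemma orth_proj_fixes: "x \<in> L \<Longrightarrow> orth_proj L x = x"
  by (rule orth_proj_eqI[OF L]) (auto simp: subspace_0 subspace_orthogonal_comp)

lemma orth_proj_pythagoras: "(norm (orth_proj L x))\<^sup>2 + (norm (x - orth_proj L x))\<^sup>2 = (norm x)\<^sup>2"
  using inner_orthogonal_comp[OF orth_proj_residual orth_proj_mem, of x x]
  unfolding power2_norm_eq_inner inner_diff_left inner_diff_right by linarith

lemma norm_orth_proj_le: "norm (orth_proj L x) \<le> norm x"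
  and norm_orth_proj_residual_le: "norm (x - orth_proj L x) \<le> norm x"
proof -
  have "(norm (orth_proj L x))\<^sup>2 \<le> (norm x)\<^sup>2" "(norm (x - orth_proj L x))\<^sup>2 \<le> (norm x)\<^sup>2"
    unfolding orth_proj_pythagoras[of x, symmetric] by simp_all
  then show "norm (orth_proj L x) \<le> norm x" "norm (x - orth_proj L x) \<le> norm x"
    by (auto dest: power2_le_imp_le)
qed

lemma bounded_linear_orth_proj: "bounded_linear (orth_proj L)"
proof (rule bounded_linear_intro[of _ 1])
  show "orth_proj L (x + y) = orth_proj L x + orth_proj L y" for x y
  proof (rule orth_proj_eqI[OF L])
    have "(x - orth_proj L x) + (y - orth_proj L y) \<in> L\<^sup>\<bottom>"
      by (intro subspace_add subspace_orthogonal_comp orth_proj_residual)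
    then show "x + y - (orth_proj L x + orth_proj L y) \<in> L\<^sup>\<bottom>" by (simp add: algebra_simps)
  qed (intro subspace_add L orth_proj_mem)
  show "orth_proj L (r *\<^sub>R x) = r *\<^sub>R orth_proj L x" for r x
  proof (rule orth_proj_eqI[OF L])
    have "r *\<^sub>R (x - orth_proj L x) \<in> L\<^sup>\<bottom>"
      by (intro subspace_scale subspace_orthogonal_comp orth_proj_residual)
    then show "r *\<^sub>R x - r *\<^sub>R orth_proj L x \<in> L\<^sup>\<bottom>" by (simp add: algebra_simps)
  qed (intro subspace_scale L orth_proj_mem)
  show "norm (orth_proj L x) \<le> norm x * 1" for x using norm_orth_proj_le[of x] by simp
qed

lemma inner_orth_proj_left: "inner (orth_proj L x) y = inner (orth_proj L x) (orth_proj L y)"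
  using inner_orthogonal_comp(2)[OF orth_proj_residual[of y] orth_proj_mem[of x]]
  unfolding inner_diff_right by linarith

lemma orth_proj_selfadjoint: "inner (orth_proj L x) y = inner x (orth_proj L y)"
proof -
  have "inner (orth_proj L x) y = inner (orth_proj L x) (orth_proj L y)"
    by (rule inner_orth_proj_left)
  also have "\<dots> = inner (orth_proj L y) (orth_proj L x)" by (rule inner_commute)
  also have "\<dots> = inner (orth_proj L y) x" by (rule inner_orth_proj_left[symmetric])
  also have "\<dots> = inner x (orth_proj L y)" by (rule inner_commute)
  finally show ?thesis .
qed

lemma inner_orth_proj_residual:
  "inner (x - orth_proj L x) y = inner (x - orth_proj L x) (y - orth_proj L y)"
  using inner_orthogonal_comp(1)[OF orth_proj_residual[of x] orth_proj_mem[of y]]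
  unfolding inner_diff_right[of "x - orth_proj L x" y] by linarith

lemma norm_orth_proj_residual_le_dist:
  assumes "y \<in> L"
  shows "norm (x - orth_proj L x) \<le> norm (x - y)"
proof -
  have eq: "x - orth_proj L x = (x - y) - orth_proj L (x - y)"
    using orth_proj_fixes[OF assms]
    by (simp add: linear_diff[OF bounded_linear.linear[OF bounded_linear_orth_proj]])
  show ?thesis by (subst eq) (rule norm_orth_proj_residual_le)
qed

end

section \<open>Two consequences of completeness\<close>

text \<open>Banach and Steinhaus: the sets of points where the whole family is bounded by \<open>n\<close> are
  closed and cover the space, so by Baire one of them contains a ball; linearity transports the
  bound from that ball to the unit ball.\<close>

lemma uniform_boundedness_principle:
  fixes F :: "('a::{real_normed_vector, complete_space} \<Rightarrow> 'b::real_normed_vector) set"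
  assumes lin: "\<And>f. f \<in> F \<Longrightarrow> bounded_linear f"
    and pointwise: "\<And>x. \<exists>C. \<forall>f\<in>F. norm (f x) \<le> C"
  obtains C where "C \<ge> 0" "\<And>f x. f \<in> F \<Longrightarrow> norm (f x) \<le> C * norm x"
proof -
  define A where "A n = {x. \<forall>f\<in>F. norm (f x) \<le> real n}" for n
  have A_closed: "closed (A n)" for n
  proof -
    have "A n = (\<Inter>f\<in>F. {x. norm (f x) \<le> real n})" by (auto simp: A_def)
    moreover have "closed {x. norm (f x) \<le> real n}" if "f \<in> F" for f
      using lin[OF that]
      by (intro closed_Collect_le continuous_intros linear_continuous_on)
    ultimately show ?thesis by auto
  qed
  have cover: "(\<Union>n. A n) = UNIV"
  proof -
    have "\<exists>n. x \<in> A n" for x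
    proof -
      obtain C where C: "\<forall>f\<in>F. norm (f x) \<le> C" using pointwise by blast
      obtain n where "C \<le> real n" using real_arch_simple by blast
      with C show ?thesis by (auto simp: A_def intro: order_trans)
    qed
    then show ?thesis by blast
  qed
  have "\<exists>n. (euclidean :: 'a topology) interior_of (A n) \<noteq> {}"
  proof (rule ccontr)
    assume "\<not> ?thesis"
    then have "(euclidean :: 'a topology) interior_of (\<Union>(range A)) = {}"
      by (intro Baire_category_alt)
        (auto simp: completely_metrizable_space_euclidean A_closed simp flip: closed_closedin)
    with cover show False by (metis UNIV_not_empty interior_of_topspace topspace_euclidean)
  qed
  then obtain n U x0 where U: "open U" "x0 \<in> U" "U \<subseteq> A n"
    by (auto simp: interior_of_def)
  then obtain e where e: "e > 0" "cball x0 e \<subseteq> A n"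
    by (meson open_contains_cball order_trans)
  have "norm (f x) \<le> (2 * real n / e) * norm x" if f: "f \<in> F" for f x
  proof (cases "x = 0")
    case True
    then show ?thesis using linear_0[OF bounded_linear.linear[OF lin[OF f]]] by simp
  next
    case False
    define y where "y = (e / norm x) *\<^sub>R x"
    have "norm y = e" using e False by (simp add: y_def)
    then have "x0 + y \<in> A n" "x0 \<in> A n" using e by (auto simp: dist_norm subset_eq)
    then have "norm (f (x0 + y)) \<le> n" "norm (f x0) \<le> n" using f by (auto simp: A_def)
    moreover have "f y = f (x0 + y) - f x0"
      by (simp add: linear_add[OF bounded_linear.linear[OF lin[OF f]]])
    ultimately have "norm (f y) \<le> 2 * real n"
      using norm_triangle_ineq4[of "f (x0 + y)" "f x0"] by simp
    moreover have "norm (f y) = (e / norm x) * norm (f x)"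
      using e by (simp add: y_def linear_scale[OF bounded_linear.linear[OF lin[OF f]]])
    ultimately show ?thesis using e False by (simp add: field_simps)
  qed
  then show ?thesis using e by (intro that[of "2 * real n / e"]) auto
qed

text \<open>Neumann's series in disguise: for \<open>z \<in> N\<close> the contraction \<open>y \<mapsto> z + T\<^sup>k y\<close> of \<open>N\<close> has a fixed
  point \<open>y\<close>, and \<open>z = (I - T\<^sup>k) y = (I - T) (y + T y + \<dots> + T\<^bsup>k-1\<^esup> y)\<close>.\<close>

lemma contracting_power_imp_subset_range:
  fixes N :: "'a::{real_normed_vector, complete_space} set"
  assumes N: "subspace N" "closed N" and T: "linear T" "\<And>x. x \<in> N \<Longrightarrow> T x \<in> N"
    and q: "0 \<le> q" "q < 1" and contr: "\<And>x. x \<in> N \<Longrightarrow> norm ((T ^^ k) x) \<le> q * norm x"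
  shows "N \<subseteq> range (\<lambda>x. x - T x)"
proof
  fix z assume z: "z \<in> N"
  have lin: "linear (T ^^ j)" for j
  proof (induction j)
    case (Suc j)
    from linear_compose[OF this T(1)] show ?case unfolding funpow.simps .
  qed (simp add: linear_iff)
  have pow: "(T ^^ j) x \<in> N" if "x \<in> N" for j x by (induction j) (simp_all add: that T(2))
  have "\<exists>!y\<in>N. z + (T ^^ k) y = y"
  proof (rule Banach_fix[OF _ _ q])
    show "complete N" using N complete_eq_closed by blast
    show "N \<noteq> {}" using z by blast
    show "(\<lambda>y. z + (T ^^ k) y) ` N \<subseteq> N" using z pow N by (auto intro: subspace_add)
    fix x y assume "x \<in> N" "y \<in> N"
    then have "x - y \<in> N" using N by (auto intro: subspace_diff)
    from contr[OF this] show "dist (z + (T ^^ k) x) (z + (T ^^ k) y) \<le> q * dist x y"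
      by (simp add: dist_norm linear_diff[OF lin])
  qed
  then obtain y where y: "z + (T ^^ k) y = y" by blast
  have "y - (T ^^ k) y = (\<Sum>j<k. (T ^^ j) y) - T (\<Sum>j<k. (T ^^ j) y)"
    using sum_lessThan_telescope'[of "\<lambda>j. (T ^^ j) y" k]
    by (simp add: linear_sum[OF T(1)] sum_subtractf)
  moreover have "z = y - (T ^^ k) y" using y by (metis add_diff_cancel_right')
  ultimately show "z \<in> range (\<lambda>x. x - T x)" by blast
qed

section \<open>Cyclic projections\<close>

text \<open>The adjoint \<open>P\<^bsub>M 1\<^esub> \<dots> P\<^bsub>M n\<^esub>\<close> of the cyclic product.\<close>

primrec reverse_cyclic_proj :: "(nat \<Rightarrow> 'a::{real_inner, complete_space} set) \<Rightarrow> nat \<Rightarrow> 'a \<Rightarrow> 'a"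
  where
    "reverse_cyclic_proj M 0 = id"
  | "reverse_cyclic_proj M (Suc n) = reverse_cyclic_proj M n \<circ> orth_proj (M (Suc n))"

locale closed_subspace_family =
  fixes M :: "nat \<Rightarrow> 'a::{real_inner, complete_space} set" and m :: nat
  assumes subspace_M: "\<And>i. i \<in> {1..m} \<Longrightarrow> subspace (M i)"
    and closed_M: "\<And>i. i \<in> {1..m} \<Longrightarrow> closed (M i)"
begin

abbreviation common :: "'a set" where "common \<equiv> common_subspace M m"
abbreviation T :: "'a \<Rightarrow> 'a" where "T \<equiv> cyclic_proj M m"

definition S :: "'a \<Rightarrow> 'a" where "S = (\<lambda>x. x - T x)"

definition displacement :: "'a \<Rightarrow> real"
  where "displacement x = (\<Sum>i=1..m. norm (x - orth_proj (M i) x))"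

lemma subspace_common: "subspace common"
  unfolding common_subspace_def by (rule subspace_Inter) (use subspace_M in auto)

lemma closed_common: "closed common"
  unfolding common_subspace_def by (rule closed_INT) (use closed_M in auto)

lemma bounded_linear_cyclic_proj: "n \<le> m \<Longrightarrow> bounded_linear (cyclic_proj M n)"
proof (induction n)
  case (Suc n)
  then show ?case
    unfolding cyclic_proj.simps o_def
    by (intro bounded_linear_compose[OF bounded_linear_orth_proj] subspace_M closed_M) auto
qed (simp add: id_def bounded_linear_ident)

lemma bounded_linear_T: "bounded_linear T"
  by (rule bounded_linear_cyclic_proj) simp

lemma bounded_linear_T_pow: "bounded_linear (T ^^ k)"
proof (induction k)
  case (Suc k)
  from bounded_linear_compose[OF bounded_linear_T this] show ?case
    unfolding funpow.simps o_def .
qed (simp add: id_def bounded_linear_ident)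

lemma linear_S: "linear S"
  unfolding S_def
  by (intro bounded_linear.linear bounded_linear_sub bounded_linear_ident bounded_linear_T)

lemma linear_S_pow: "linear (S ^^ p)"
proof (induction p)
  case (Suc p)
  from linear_compose[OF this linear_S] show ?case unfolding funpow.simps .
qed (simp add: linear_iff)

lemma inner_cyclic_proj_adjoint:
  "n \<le> m \<Longrightarrow> inner (cyclic_proj M n x) y = inner x (reverse_cyclic_proj M n y)"
proof (induction n arbitrary: y)
  case (Suc n)
  have "inner (cyclic_proj M (Suc n) x) y
      = inner (cyclic_proj M n x) (orth_proj (M (Suc n)) y)"
    using Suc.prems by (simp add: orth_proj_selfadjoint subspace_M closed_M)
  then show ?case using Suc by simp
qed simp

lemma cyclic_proj_fixes: "\<lbrakk>n \<le> m; x \<in> common\<rbrakk> \<Longrightarrow> cyclic_proj M n x = x"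
proof (induction n)
  case (Suc n)
  then have "x \<in> M (Suc n)" by (auto simp: common_subspace_def)
  then show ?case using Suc by (simp add: orth_proj_fixes subspace_M closed_M)
qed simp

lemma reverse_cyclic_proj_fixes: "\<lbrakk>n \<le> m; x \<in> common\<rbrakk> \<Longrightarrow> reverse_cyclic_proj M n x = x"
proof (induction n)
  case (Suc n)
  then have "x \<in> M (Suc n)" by (auto simp: common_subspace_def)
  then show ?case using Suc by (simp add: orth_proj_fixes subspace_M closed_M)
qed simp

text \<open>Since \<open>T\<^sup>*\<close> fixes the common subspace pointwise, \<open>(T x, y) = (x, y)\<close> for \<open>y \<in> M\<close>.\<close>

lemma S_mem: "S x \<in> common\<^sup>\<bottom>"
  by (rule orthogonal_compI)
    (simp add: S_def inner_diff_left inner_cyclic_proj_adjoint reverse_cyclic_proj_fixes)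

lemma T_mem: "x \<in> common\<^sup>\<bottom> \<Longrightarrow> T x \<in> common\<^sup>\<bottom>"
  by (rule orthogonal_compI)
    (simp add: inner_cyclic_proj_adjoint reverse_cyclic_proj_fixes inner_orthogonal_comp)

lemma T_pow_mem: "x \<in> common\<^sup>\<bottom> \<Longrightarrow> (T ^^ k) x \<in> common\<^sup>\<bottom>"
  by (induction k) (simp_all add: T_mem)

lemma S_pow_mem: "x \<in> common\<^sup>\<bottom> \<Longrightarrow> (S ^^ p) x \<in> common\<^sup>\<bottom>"
  by (induction p) (simp_all add: S_mem)

lemma sum_complements_orthogonal: "sum_complements M m \<subseteq> common\<^sup>\<bottom>"
proof
  fix e assume "e \<in> sum_complements M m"
  then obtain s where e: "e = sum s {1..m}" and s: "\<And>i. i \<in> {1..m} \<Longrightarrow> s i \<in> (M i)\<^sup>\<bottom>"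
    by (auto simp: sum_complements_def set_sum_alt)
  have "s i \<in> common\<^sup>\<bottom>" if i: "i \<in> {1..m}" for i
  proof -
    have "common \<subseteq> M i" using i unfolding common_subspace_def by blast
    then show ?thesis using s[OF i] orthogonal_comp_anti_mono by blast
  qed
  then show "e \<in> common\<^sup>\<bottom>" unfolding e by (intro subspace_sum subspace_orthogonal_comp)
qed

text \<open>Each factor \<open>P\<^bsub>M i\<^esub>\<close> of the product displaces its argument by a vector of \<open>M\<^sub>i\<^sup>\<bottom>\<close>, and
  \<open>x - T x\<close> is the sum of these displacements.\<close>

lemma range_S_subset_sum_complements: "range S \<subseteq> sum_complements M m"
proof -
  have "n \<le> m \<Longrightarrow> x - cyclic_proj M n x \<in> (\<Sum>i=1..n. (M i)\<^sup>\<bottom>)" for n x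
  proof (induction n)
    case (Suc n)
    let ?u = "cyclic_proj M n x"
    have "?u - orth_proj (M (Suc n)) ?u \<in> (M (Suc n))\<^sup>\<bottom>"
      using Suc.prems by (intro orth_proj_residual subspace_M closed_M) auto
    with Suc have "(x - ?u) + (?u - orth_proj (M (Suc n)) ?u)
        \<in> (\<Sum>i=1..n. (M i)\<^sup>\<bottom>) + (M (Suc n))\<^sup>\<bottom>" by (intro set_plus_intro) auto
    then show ?case by simp
  qed simp
  then show ?thesis by (auto simp: S_def sum_complements_def)
qed

text \<open>Hence surjectivity of \<open>I - T\<close> onto \<open>M\<^sup>\<bottom>\<close> is incompatible with a sum of complements that
  is not closed; the failure of any part of the theorem is refuted through this lemma.\<close>

lemma sum_complements_closed_if_S_onto:
  assumes "common\<^sup>\<bottom> \<subseteq> range S"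
  shows "closed (sum_complements M m)"
proof -
  have "sum_complements M m = common\<^sup>\<bottom>"
    using assms range_S_subset_sum_complements sum_complements_orthogonal by blast
  then show ?thesis by (simp add: closed_orthogonal_comp)
qed

lemma S_onto_if_power_contracts:
  assumes "0 \<le> q" "q < 1" "\<And>x. x \<in> common\<^sup>\<bottom> \<Longrightarrow> norm ((T ^^ k) x) \<le> q * norm x"
  shows "common\<^sup>\<bottom> \<subseteq> range S"
  unfolding S_def
  using assms T_mem bounded_linear.linear[OF bounded_linear_T]
  by (intro contracting_power_imp_subset_range subspace_orthogonal_comp closed_orthogonal_comp)

text \<open>By Pythagoras the squared steps along one cycle sum to the loss of squared norm.\<close>

lemma cyclic_proj_norm_loss:
  "n \<le> m \<Longrightarrow> (\<Sum>j<n. (norm (cyclic_proj M j x - cyclic_proj M (Suc j) x))\<^sup>2)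
    = (norm x)\<^sup>2 - (norm (cyclic_proj M n x))\<^sup>2"
proof (induction n)
  case (Suc n)
  have "(norm (cyclic_proj M (Suc n) x))\<^sup>2 + (norm (cyclic_proj M n x - cyclic_proj M (Suc n) x))\<^sup>2
      = (norm (cyclic_proj M n x))\<^sup>2"
    unfolding cyclic_proj.simps o_def
    by (rule orth_proj_pythagoras) (use Suc.prems subspace_M closed_M in auto)
  with Suc show ?case by simp
qed simp

text \<open>The cycle visits every \<open>M\<^sub>i\<close>, so the distance of \<open>x\<close> to each \<open>M\<^sub>i\<close> is at most the length of
  the path, which Cauchy and Schwarz compare with the loss of squared norm.\<close>

lemma residual_le_norm_loss:
  assumes i: "i \<in> {1..m}"
  shows "(norm (x - orth_proj (M i) x))\<^sup>2 \<le> real m * ((norm x)\<^sup>2 - (norm (T x))\<^sup>2)"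
proof -
  define step where "step j = norm (cyclic_proj M j x - cyclic_proj M (Suc j) x)" for j
  have path: "norm (x - cyclic_proj M n x) \<le> (\<Sum>j<n. step j)" for n
  proof (induction n)
    case (Suc n)
    have "norm (x - cyclic_proj M (Suc n) x) \<le> norm (x - cyclic_proj M n x) + step n"
      unfolding step_def
      using norm_triangle_ineq[of "x - cyclic_proj M n x" "cyclic_proj M n x - cyclic_proj M (Suc n) x"]
      by simp
    with Suc show ?case by simp
  qed simp
  obtain i' where i': "i = Suc i'" using i by (cases i) auto
  have "cyclic_proj M i x \<in> M i"
    unfolding i' cyclic_proj.simps o_def
    by (rule orth_proj_mem) (use i i' subspace_M closed_M in auto)
  then have "norm (x - orth_proj (M i) x) \<le> norm (x - cyclic_proj M i x)"
    using i subspace_M closed_M by (intro norm_orth_proj_residual_le_dist) auto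
  also have "\<dots> \<le> (\<Sum>j<i. step j)" by (rule path)
  also have "\<dots> \<le> (\<Sum>j<m. step j)" using i by (intro sum_mono2) (auto simp: step_def)
  finally have "(norm (x - orth_proj (M i) x))\<^sup>2 \<le> (\<Sum>j<m. step j)\<^sup>2" by (intro power_mono) auto
  also have "\<dots> \<le> (\<Sum>j<m. (step j)\<^sup>2) * real (card {..<m})" by (rule sum_squared_le_sum_of_squares)
  also have "(\<Sum>j<m. (step j)\<^sup>2) = (norm x)\<^sup>2 - (norm (T x))\<^sup>2"
    unfolding step_def by (rule cyclic_proj_norm_loss) simp
  finally show ?thesis by (simp add: mult.commute)
qed

text \<open>A fixed point loses no norm along the cycle, so every projection leaves it in place.\<close>

lemma fixed_point_mem_common:
  assumes "T x = x"
  shows "x \<in> common"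
proof -
  have "x \<in> M i" if i: "i \<in> {1..m}" for i
  proof -
    have "(norm (x - orth_proj (M i) x))\<^sup>2 \<le> 0" using residual_le_norm_loss[OF i, of x] assms by simp
    then have "x = orth_proj (M i) x" by simp
    then show ?thesis using orth_proj_mem[OF subspace_M closed_M, OF i i, of x] by simp
  qed
  then show ?thesis by (auto simp: common_subspace_def)
qed

lemma S_eq_0_imp_eq_0:
  assumes "x \<in> common\<^sup>\<bottom>" "S x = 0"
  shows "x = 0"
  using assms fixed_point_mem_common[of x] mem_orthogonal_comp_self_eq_0 by (auto simp: S_def)

lemma S_pow_eq_0_imp_eq_0: "\<lbrakk>x \<in> common\<^sup>\<bottom>; (S ^^ p) x = 0\<rbrakk> \<Longrightarrow> x = 0"
proof (induction p)
  case (Suc p)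
  then show ?case using S_eq_0_imp_eq_0[OF S_pow_mem[of x p]] by simp
qed simp

section \<open>Linear regularity\<close>

lemma displacement_nonneg: "displacement x \<ge> 0"
  unfolding displacement_def by (intro sum_nonneg) auto

lemma residual_le_displacement:
  assumes "i \<in> {1..m}"
  shows "norm (x - orth_proj (M i) x) \<le> displacement x"
  unfolding displacement_def using assms by (intro member_le_sum) auto

lemma displacement_le_norm: "displacement x \<le> real m * norm x"
proof -
  have "displacement x \<le> (\<Sum>i=1..m. norm x)"
    unfolding displacement_def
    by (intro sum_mono norm_orth_proj_residual_le subspace_M closed_M)
  then show ?thesis by simp
qed

text \<open>Under linear regularity the norm of a vector of \<open>M\<^sup>\<bottom>\<close> is at most a constant times the square
  root of the loss of squared norm in one cycle, so \<open>T\<close> itself contracts \<open>M\<^sup>\<bottom>\<close>.\<close>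

lemma S_onto_if_linearly_regular:
  assumes reg: "\<And>y. y \<in> common\<^sup>\<bottom> \<Longrightarrow> norm y \<le> C * displacement y"
  shows "common\<^sup>\<bottom> \<subseteq> range S"
proof -
  \<comment> \<open>One factor \<open>m\<close> comes from \<open>residual_le_norm_loss\<close>, one from Cauchy-Schwarz for the
    sum over \<open>i\<close> and one from its number of terms; the summand \<open>1\<close> makes \<open>1 - 1 / K\<close> a nonnegative number.\<close>
  define K where "K = 1 + C\<^sup>2 * (real m) ^ 3"
  have K: "K \<ge> 1" by (simp add: K_def)
  have loss: "(norm y)\<^sup>2 \<le> K * ((norm y)\<^sup>2 - (norm (T y))\<^sup>2)" if y: "y \<in> common\<^sup>\<bottom>" for y
  proof -
    define l where "l = (norm y)\<^sup>2 - (norm (T y))\<^sup>2"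
    have l: "l \<ge> 0"
      using cyclic_proj_norm_loss[of m y] by (simp add: l_def sum_nonneg flip: cyclic_proj_norm_loss)
    have "(norm y)\<^sup>2 \<le> (C * displacement y)\<^sup>2" using reg[OF y] by (intro power_mono) auto
    also have "\<dots> = C\<^sup>2 * (displacement y)\<^sup>2" by (simp add: power_mult_distrib)
    also have "(displacement y)\<^sup>2 \<le> (\<Sum>i=1..m. (norm (y - orth_proj (M i) y))\<^sup>2) * real (card {1..m})"
      unfolding displacement_def by (rule sum_squared_le_sum_of_squares)
    also have "(\<Sum>i=1..m. (norm (y - orth_proj (M i) y))\<^sup>2) \<le> (\<Sum>i=1..m. real m * l)"
      unfolding l_def by (intro sum_mono residual_le_norm_loss)
    finally have "(norm y)\<^sup>2 \<le> C\<^sup>2 * (real m ^ 3 * l)"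
      by (simp add: mult_left_mono mult_right_mono power3_eq_cube ac_simps)
    also have "\<dots> \<le> K * l" using l by (simp add: K_def algebra_simps)
    finally show ?thesis by (simp add: l_def)
  qed
  show ?thesis
  proof (rule S_onto_if_power_contracts)
    show "0 \<le> sqrt (1 - 1 / K)" "sqrt (1 - 1 / K) < 1" using K by simp_all
    fix y assume y: "y \<in> common\<^sup>\<bottom>"
    have "(norm (T y))\<^sup>2 \<le> (1 - 1 / K) * (norm y)\<^sup>2"
      using loss[OF y] K by (simp add: field_simps)
    from real_sqrt_le_mono[OF this] show "norm ((T ^^ 1) y) \<le> sqrt (1 - 1 / K) * norm y"
      by (simp add: real_sqrt_mult)
  qed
qed

text \<open>The vector \<open>x - T x\<close> is the sum of the steps \<open>u - P\<^bsub>M i\<^esub> u\<close> of the cycle. Such a step lies in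
  \<open>M\<^sub>i\<^sup>\<bottom>\<close>, so it pairs only with the component of \<open>z\<close> there, whose norm is at most
  \<open>displacement z\<close>; and its own norm exceeds that of \<open>x - P\<^bsub>M i\<^esub> x\<close> by at most \<open>|x - u|\<close>, which the
  bound for the earlier steps, applied to \<open>z = x - u\<close>, controls by \<open>displacement x\<close>.\<close>

lemma S_pairing_le_displacements:
  obtains C where "C \<ge> 0" "\<And>x z. inner (S x) z \<le> C * displacement x * displacement z"
proof -
  have "n \<le> m \<Longrightarrow> \<exists>C\<ge>0. \<forall>x z. inner (x - cyclic_proj M n x) z \<le> C * displacement x * displacement z"
    for n
  proof (induction n)
    case 0
    show ?case by (rule exI[of _ 0]) simp
  next
    case (Suc n)
    then obtain C where C: "C \<ge> 0"
      "\<And>x z. inner (x - cyclic_proj M n x) z \<le> C * displacement x * displacement z" by auto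
    let ?P = "orth_proj (M (Suc n))"
    have n: "Suc n \<in> {1..m}" using Suc.prems by simp
    note P = subspace_M[OF n] closed_M[OF n]
    have "inner (x - cyclic_proj M (Suc n) x) z
        \<le> (C + (1 + C * real m)) * displacement x * displacement z" for x z
    proof -
      define u where "u = cyclic_proj M n x"
      have "(norm (x - u))\<^sup>2 \<le> C * displacement x * displacement (x - u)"
        using C(2)[of x "x - u"] by (simp add: u_def power2_norm_eq_inner)
      also have "\<dots> \<le> C * displacement x * (real m * norm (x - u))"
        using C(1) by (intro mult_left_mono displacement_le_norm) (simp add: displacement_nonneg)
      finally have "norm (x - u) * norm (x - u) \<le> (C * displacement x * real m) * norm (x - u)"
        by (simp add: power2_eq_square algebra_simps)
      then have xu: "norm (x - u) \<le> C * displacement x * real m"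
        using C(1) displacement_nonneg[of x] by (cases "x = u") auto
      have "u - ?P u = (x - ?P x) - ((x - u) - ?P (x - u))"
        by (simp add: linear_diff[OF bounded_linear.linear[OF bounded_linear_orth_proj[OF P]]])
      then have "norm (u - ?P u) \<le> norm (x - ?P x) + norm ((x - u) - ?P (x - u))"
        by (metis norm_triangle_ineq4)
      also have "\<dots> \<le> displacement x + norm (x - u)"
        by (intro add_mono residual_le_displacement n norm_orth_proj_residual_le P)
      finally have u: "norm (u - ?P u) \<le> (1 + C * real m) * displacement x"
        using xu by (simp add: algebra_simps)
      have "inner (u - ?P u) z \<le> norm (u - ?P u) * norm (z - ?P z)"
        unfolding inner_orth_proj_residual[OF P, of u z] by (rule norm_cauchy_schwarz)
      also have "\<dots> \<le> ((1 + C * real m) * displacement x) * displacement z"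
        using C(1) u
        by (intro mult_mono residual_le_displacement n) (auto simp: displacement_nonneg)
      finally have "inner (u - ?P u) z \<le> ((1 + C * real m) * displacement x) * displacement z" .
      moreover have "inner (x - cyclic_proj M (Suc n) x) z = inner (x - u) z + inner (u - ?P u) z"
        by (simp add: u_def flip: inner_add_left)
      ultimately show ?thesis using C(2)[of x z] by (simp add: u_def algebra_simps)
    qed
    then show ?case using C(1) by (intro exI[of _ "C + (1 + C * real m)"]) auto
  qed
  from this[of m] show ?thesis using that by (auto simp: S_def)
qed

definition S_adj :: "'a \<Rightarrow> 'a" where "S_adj x = x - reverse_cyclic_proj M m x"

lemma inner_S_adj: "inner (S x) y = inner x (S_adj y)"
  by (simp add: S_def S_adj_def inner_diff_left inner_diff_right inner_cyclic_proj_adjoint)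

lemma linear_S_adj: "linear S_adj"
proof -
  have "n \<le> m \<Longrightarrow> linear (reverse_cyclic_proj M n)" for n
  proof (induction n)
    case (Suc n)
    have "linear (orth_proj (M (Suc n)))"
      by (intro bounded_linear.linear bounded_linear_orth_proj subspace_M closed_M)
        (use Suc.prems in auto)
    moreover have "linear (reverse_cyclic_proj M n)" using Suc by simp
    ultimately show ?case unfolding reverse_cyclic_proj.simps by (rule linear_compose)
  qed (simp add: linear_iff)
  from this[of m] show ?thesis by (simp add: linear_iff S_adj_def algebra_simps)
qed

lemma S_adj_mem: "S_adj x \<in> common\<^sup>\<bottom>"
  by (rule orthogonal_compI)
    (simp add: inner_commute[of "S_adj x"] inner_S_adj[symmetric], simp add: S_def cyclic_proj_fixes)

lemma complement_subset_sum_complements: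
  assumes i: "i \<in> {1..m}"
  shows "(M i)\<^sup>\<bottom> \<subseteq> sum_complements M m"
proof
  fix e assume e: "e \<in> (M i)\<^sup>\<bottom>"
  define s where "s j = (if j = i then e else 0)" for j
  have "sum s {1..m} = e" using i by (simp add: s_def)
  moreover have "\<forall>j\<in>{1..m}. s j \<in> (M j)\<^sup>\<bottom>"
    using e by (simp add: s_def subspace_0 subspace_orthogonal_comp)
  ultimately show "e \<in> sum_complements M m"
    unfolding sum_complements_def by (subst set_sum_alt) auto
qed

text \<open>If \<open>S w = z - P\<^bsub>M i\<^esub> z\<close>, then \<open>(x - P\<^bsub>M i\<^esub> x, z) = (S\<^sup>* x, w)\<close> for all \<open>x\<close>. So the functionals
  \<open>z \<mapsto> (x - P\<^bsub>M i\<^esub> x, z) / |S\<^sup>* x|\<close> are bounded at \<open>z\<close> by \<open>|w|\<close>, and such a \<open>w\<close> exists for every \<open>z\<close>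
  by assumption.\<close>

lemma residual_le_norm_S_adj:
  assumes sub: "sum_complements M m \<subseteq> range S" and i: "i \<in> {1..m}"
  obtains C where "C \<ge> 0" "\<And>x. norm (x - orth_proj (M i) x) \<le> C * norm (S_adj x)"
proof -
  define Q where "Q x = x - orth_proj (M i) x" for x
  note P = subspace_M[OF i] closed_M[OF i]
  have key: "\<exists>w. \<forall>x. inner (Q x) z = inner w (S_adj x)" for z
  proof -
    have "Q z \<in> range S"
      using orth_proj_residual[OF P] complement_subset_sum_complements[OF i] sub
      unfolding Q_def by blast
    then obtain w where w: "Q z = S w" by blast
    have "inner (Q x) z = inner w (S_adj x)" for x
    proof -
      have "inner (Q x) z = inner (Q x) (Q z)"
        unfolding Q_def by (rule inner_orth_proj_residual[OF P])
      also have "\<dots> = inner (Q z) (Q x)" by (rule inner_commute)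
      also have "\<dots> = inner (Q z) x"
        unfolding Q_def by (rule inner_orth_proj_residual[OF P, symmetric])
      finally show ?thesis by (simp add: w inner_S_adj)
    qed
    then show ?thesis by blast
  qed
  define F where "F = range (\<lambda>x. inner (inverse (norm (S_adj x)) *\<^sub>R Q x))"
  have "bounded_linear f" if "f \<in> F" for f
    using that by (auto simp: F_def simp del: inner_scaleR_left intro: bounded_linear_inner_right)
  moreover have "\<exists>C. \<forall>f\<in>F. norm (f z) \<le> C" for z
  proof -
    obtain w where w: "\<And>x. inner (Q x) z = inner w (S_adj x)" using key by blast
    have "norm (inner (inverse (norm (S_adj x)) *\<^sub>R Q x) z) \<le> norm w" for x
    proof (cases "S_adj x = 0")
      case False
      have "\<bar>inner w (S_adj x)\<bar> \<le> norm w * norm (S_adj x)" by (rule Cauchy_Schwarz_ineq2)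
      with False show ?thesis by (simp add: w abs_mult field_simps)
    qed simp
    then show ?thesis by (auto simp: F_def)
  qed
  ultimately obtain C where C: "C \<ge> 0" "\<And>f z. f \<in> F \<Longrightarrow> norm (f z) \<le> C * norm z"
    using uniform_boundedness_principle[of F] by blast
  have "norm (Q x) \<le> C * norm (S_adj x)" for x
  proof (cases "S_adj x = 0")
    case True
    obtain w where "\<And>y. inner (Q y) (Q x) = inner w (S_adj y)" using key by blast
    from this[of x] True show ?thesis by simp
  next
    case False
    have "norm (inner (inverse (norm (S_adj x)) *\<^sub>R Q x) (Q x)) \<le> C * norm (Q x)"
      by (rule C(2)[of "inner (inverse (norm (S_adj x)) *\<^sub>R Q x)"]) (unfold F_def, rule rangeI)
    then have "norm (Q x) * norm (Q x) \<le> (C * norm (S_adj x)) * norm (Q x)"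
      using False by (simp add: field_simps flip: power2_norm_eq_inner) (simp add: power2_eq_square)
    then show ?thesis using C(1) by (cases "Q x = 0") auto
  qed
  then show ?thesis using that C(1) by (auto simp: Q_def)
qed

text \<open>For \<open>y = S\<^sup>* x\<close> one has \<open>|y|\<^sup>2 = (S y, x)\<close>, which is at most a constant times
  \<open>displacement y * displacement x\<close>, and the second factor is controlled by \<open>|y|\<close> itself. Such \<open>y\<close>
  are dense in \<open>M\<^sup>\<bottom>\<close>, because \<open>S\<close> is injective there.\<close>

lemma S_onto_if_sum_complements_subset_range_S:
  assumes sub: "sum_complements M m \<subseteq> range S"
  shows "common\<^sup>\<bottom> \<subseteq> range S"
proof -
  have "\<exists>C. \<forall>i\<in>{1..m}. \<forall>x. norm (x - orth_proj (M i) x) \<le> C i * norm (S_adj x)"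
    using residual_le_norm_S_adj[OF sub] by (intro bchoice ballI) metis
  then obtain c where c: "\<And>i x. i \<in> {1..m} \<Longrightarrow> norm (x - orth_proj (M i) x) \<le> c i * norm (S_adj x)"
    by blast
  have disp: "displacement x \<le> sum c {1..m} * norm (S_adj x)" for x
    unfolding displacement_def sum_distrib_right by (intro sum_mono c)
  obtain B where B: "B \<ge> 0" "\<And>x z. inner (S x) z \<le> B * displacement x * displacement z"
    using S_pairing_le_displacements by blast
  define K where "K = B * sum c {1..m}"
  have range: "norm (S_adj x) \<le> K * displacement (S_adj x)" for x
  proof (cases "S_adj x = 0")
    case True
    then show ?thesis by (simp add: displacement_def linear_0 bounded_linear.linear
          bounded_linear_orth_proj subspace_M closed_M)
  next
    case False
    let ?y = "S_adj x"
    have "norm ?y * norm ?y = inner (S ?y) x"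
      by (metis inner_S_adj inner_commute power2_eq_square power2_norm_eq_inner)
    also have "\<dots> \<le> B * displacement ?y * displacement x" by (rule B)
    also have "\<dots> \<le> B * displacement ?y * (sum c {1..m} * norm ?y)"
      using B(1) by (intro mult_left_mono disp) (simp add: displacement_nonneg)
    finally have "norm ?y * norm ?y \<le> (K * displacement ?y) * norm ?y"
      by (simp add: K_def algebra_simps)
    then show ?thesis using False by simp
  qed
  define L where "L = closure (range S_adj)"
  have L: "subspace L" "closed L"
    unfolding L_def using linear_S_adj
    by (auto intro!: subspace_closure linear_subspace_image)
  have "L \<subseteq> common\<^sup>\<bottom>"
    unfolding L_def using S_adj_mem by (intro closure_minimal closed_orthogonal_comp) auto
  have dense: "y \<in> L" if y: "y \<in> common\<^sup>\<bottom>" for y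
  proof -
    define r where "r = y - orth_proj L y"
    have "r \<in> L\<^sup>\<bottom>" unfolding r_def by (rule orth_proj_residual[OF L])
    moreover have "S_adj w \<in> L" for w
      unfolding L_def by (rule subsetD[OF closure_subset]) (rule rangeI)
    ultimately have "inner (S r) w = 0" for w
      unfolding inner_S_adj by (rule inner_orthogonal_comp(1))
    from this[of "S r"] have "S r = 0" by simp
    moreover have "r \<in> common\<^sup>\<bottom>"
      unfolding r_def using y orth_proj_mem[OF L] \<open>L \<subseteq> common\<^sup>\<bottom>\<close>
      by (intro subspace_diff subspace_orthogonal_comp) auto
    ultimately have "r = 0" using S_eq_0_imp_eq_0 by blast
    then show "y \<in> L" using orth_proj_mem[OF L, of y] by (simp add: r_def)
  qed
  have "closed {y. norm y \<le> K * displacement y}"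
    unfolding displacement_def
    by (intro closed_Collect_le continuous_intros linear_continuous_on bounded_linear_orth_proj
        subspace_M closed_M)
  then have "L \<subseteq> {y. norm y \<le> K * displacement y}"
    unfolding L_def using range by (intro closure_minimal) auto
  with dense show ?thesis by (intro S_onto_if_linearly_regular[of K]) blast
qed

end

section \<open>Rates of convergence\<close>

text \<open>By the mean value theorem the difference on the right is \<open>s c\<^bsup>-s-1\<^esup>\<close> for some \<open>c\<close> between \<open>k\<close> and
  \<open>k + 1 \<le> 2 k\<close>; replacing \<open>c\<close> by \<open>2 k\<close> costs the factor \<open>2\<^bsup>s+1\<^esup>\<close>.\<close>

lemma powr_le_const_mult_diff:
  assumes s: "s > 0" and k: "k \<ge> 1"
  shows "real k powr (- s - 1) \<le> (2 powr (s + 1) / s) * (real k powr (- s) - real (Suc k) powr (- s))"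
proof -
  have "\<exists>c. real k < c \<and> c < real (Suc k) \<and>
    real (Suc k) powr (- s) - real k powr (- s) = (real (Suc k) - real k) * ((- s) * c powr (- s - 1))"
    using k by (intro MVT2) (auto intro!: derivative_eq_intros simp: powr_diff field_simps)
  then obtain c where c: "real k < c" "c < real (Suc k)"
    "real k powr (- s) - real (Suc k) powr (- s) = s * c powr (- s - 1)" by (auto simp: algebra_simps)
  have "(2 * real k) powr (- s - 1) \<le> c powr (- s - 1)"
    using c k s by (intro powr_mono2') auto
  moreover have "(2 * real k) powr (- s - 1) = real k powr (- s - 1) / 2 powr (s + 1)"
    using k powr_minus_divide[of 2 "s + 1"] by (simp add: powr_mult)
  ultimately have "real k powr (- s - 1) \<le> 2 powr (s + 1) * c powr (- s - 1)"
    by (simp add: divide_le_eq mult.commute)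
  then show ?thesis unfolding c(3) using s by simp
qed

text \<open>The bounds on the increments telescope after comparison with \<open>k\<^sup>-\<^sup>s - (k + 1)\<^sup>-\<^sup>s\<close>.\<close>

lemma increments_rate_imp_limit_rate:
  fixes v :: "nat \<Rightarrow> 'a::{real_normed_vector, complete_space}"
  assumes s: "s > 0" and inc: "\<And>k. k \<ge> 1 \<Longrightarrow> norm (v k - v (Suc k)) \<le> C * real k powr (- s - 1)"
  obtains l D where "v \<longlonglongrightarrow> l" "\<And>k. k \<ge> 1 \<Longrightarrow> norm (v k - l) \<le> D * real k powr (- s)"
proof -
  define D where "D = C * (2 powr (s + 1) / s)"
  have C: "C \<ge> 0" using order_trans[OF norm_ge_zero inc[of 1]] by simp
  then have D: "D \<ge> 0" using s by (simp add: D_def)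
  have tele: "norm (v k - v j) \<le> D * (real k powr (- s) - real j powr (- s))"
    if "k \<ge> 1" "k \<le> j" for k j
    using that(2)
  proof (induction j rule: dec_induct)
    case (step j)
    have "norm (v j - v (Suc j)) \<le> C * real j powr (- s - 1)" using inc step that by simp
    also have "\<dots> \<le> C * ((2 powr (s + 1) / s) * (real j powr (- s) - real (Suc j) powr (- s)))"
      using step that by (intro mult_left_mono powr_le_const_mult_diff s C) auto
    finally have "norm (v j - v (Suc j)) \<le> D * (real j powr (- s) - real (Suc j) powr (- s))"
      by (simp add: D_def)
    moreover have "norm (v k - v (Suc j)) \<le> norm (v k - v j) + norm (v j - v (Suc j))"
      using norm_triangle_ineq[of "v k - v j" "v j - v (Suc j)"] by simp
    ultimately show ?case using step.IH by (simp add: algebra_simps)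
  qed simp
  have rate: "norm (v k - v j) \<le> D * real k powr (- s)" if "k \<ge> 1" "k \<le> j" for k j
  proof -
    have "D * (real k powr (- s) - real j powr (- s)) \<le> D * real k powr (- s)"
      using D by (intro mult_left_mono) auto
    with tele[OF that] show ?thesis by linarith
  qed
  have "(\<lambda>k. D * real k powr (- s)) \<longlonglongrightarrow> D * 0"
    using s by (intro tendsto_intros tendsto_neg_powr filterlim_real_sequentially) auto
  then have small: "(\<lambda>k. D * real k powr (- s)) \<longlonglongrightarrow> 0" by simp
  have "Cauchy v"
  proof (rule metric_CauchyI)
    fix e :: real assume e: "e > 0"
    then have "eventually (\<lambda>k. D * real k powr (- s) < e / 2 \<and> k \<ge> 1) sequentially"
      using order_tendstoD(2)[OF small, of "e / 2"] eventually_ge_at_top[of 1]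
      by (intro eventually_conj) auto
    then obtain k where k: "D * real k powr (- s) < e / 2" "k \<ge> 1"
      using eventually_happens'[OF sequentially_bot] by blast
    show "\<exists>K. \<forall>i\<ge>K. \<forall>j\<ge>K. dist (v i) (v j) < e"
    proof (intro exI allI impI)
      fix i j assume "i \<ge> k" "j \<ge> k"
      then have "dist (v k) (v i) < e / 2" "dist (v k) (v j) < e / 2"
        unfolding dist_norm using rate[OF k(2)] k(1) le_less_trans by blast+
      then show "dist (v i) (v j) < e" using dist_triangle_half_r by blast
    qed
  qed
  then obtain l where l: "v \<longlonglongrightarrow> l" using Cauchy_convergent convergentD by blast
  have "norm (v k - l) \<le> D * real k powr (- s)" if k: "k \<ge> 1" for k
  proof (rule Lim_bounded)
    show "(\<lambda>j. norm (v k - v j)) \<longlonglongrightarrow> norm (v k - l)" by (intro tendsto_intros l)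
    show "\<forall>j\<ge>k. norm (v k - v j) \<le> D * real k powr (- s)" using rate[OF k] by blast
  qed
  with l show ?thesis by (rule that)
qed

context closed_subspace_family
begin

text \<open>One power of \<open>I - T\<close> is worth one power of \<open>k\<close>: the vectors \<open>T\<^sup>k (I - T) z\<close> are the
  increments of \<open>T\<^sup>k z\<close>. The limit vanishes because it is a fixed point of \<open>T\<close> orthogonal to
  \<open>M\<close>.\<close>

lemma rate_of_S_imp_rate:
  assumes z: "z \<in> common\<^sup>\<bottom>" and s: "s > 0"
    and rate: "\<And>k. k \<ge> 1 \<Longrightarrow> norm ((T ^^ k) (S z)) \<le> C * real k powr (- s - 1)"
  obtains D where "\<And>k. k \<ge> 1 \<Longrightarrow> norm ((T ^^ k) z) \<le> D * real k powr (- s)"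
proof -
  define v where "v k = (T ^^ k) z" for k
  have inc: "v k - v (Suc k) = (T ^^ k) (S z)" for k
    unfolding v_def S_def linear_diff[OF bounded_linear.linear[OF bounded_linear_T_pow]]
    by (simp add: funpow_swap1)
  obtain l D where l: "v \<longlonglongrightarrow> l" and D: "\<And>k. k \<ge> 1 \<Longrightarrow> norm (v k - l) \<le> D * real k powr (- s)"
    using increments_rate_imp_limit_rate[OF s, of v C] rate by (metis inc)
  have "(\<lambda>k. T (v k)) \<longlonglongrightarrow> T l" by (rule bounded_linear.tendsto[OF bounded_linear_T l])
  moreover have "(\<lambda>k. T (v k)) \<longlonglongrightarrow> l" using LIMSEQ_Suc[OF l] by (simp add: v_def)
  ultimately have "T l = l" by (rule LIMSEQ_unique)
  then have "l \<in> common" by (rule fixed_point_mem_common)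
  moreover have "l \<in> common\<^sup>\<bottom>"
    using closed_sequentially[OF closed_orthogonal_comp _ l] T_pow_mem[OF z] by (simp add: v_def)
  ultimately have "l = 0" by (rule mem_orthogonal_comp_self_eq_0)
  with D show ?thesis by (intro that[of D]) (simp add: v_def)
qed

lemma rate_of_S_pow_imp_rate:
  assumes z: "z \<in> common\<^sup>\<bottom>" and \<epsilon>: "\<epsilon> > 0"
  shows "(\<And>k. k \<ge> 1 \<Longrightarrow> norm ((T ^^ k) ((S ^^ p) z)) \<le> C * real k powr (- real p - \<epsilon>)) \<Longrightarrow>
    \<exists>D. \<forall>k\<ge>1. norm ((T ^^ k) z) \<le> D * real k powr (- \<epsilon>)"
proof (induction p arbitrary: C)
  case (Suc p)
  have "norm ((T ^^ k) (S ((S ^^ p) z))) \<le> C * real k powr (- (real p + \<epsilon>) - 1)" if "k \<ge> 1" for k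
  proof -
    have "- (real p + \<epsilon>) - 1 = - real (Suc p) - \<epsilon>" by simp
    then show ?thesis using Suc.prems[OF that] by (simp only: funpow.simps o_apply)
  qed
  then obtain D where "\<And>k. k \<ge> 1 \<Longrightarrow> norm ((T ^^ k) ((S ^^ p) z)) \<le> D * real k powr (- (real p + \<epsilon>))"
    using rate_of_S_imp_rate[OF S_pow_mem[OF z], of "real p + \<epsilon>" p C] \<epsilon> by auto
  then show ?case by (intro Suc.IH[of D]) simp
qed auto

text \<open>Pointwise decay \<open>T\<^sup>k x = O(k\<^sup>-\<^sup>\<epsilon>)\<close> on \<open>M\<^sup>\<bottom>\<close> is uniform on its unit ball by the uniform boundedness
  principle, hence some power of \<open>T\<close> is a contraction there.\<close>

lemma S_onto_if_pointwise_rate: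
  assumes \<epsilon>: "\<epsilon> > 0"
    and rate: "\<And>x. x \<in> common\<^sup>\<bottom> \<Longrightarrow> \<exists>D. \<forall>k\<ge>1. norm ((T ^^ k) x) \<le> D * real k powr (- \<epsilon>)"
  shows "common\<^sup>\<bottom> \<subseteq> range S"
proof -
  define Q where "Q x = x - orth_proj common x" for x
  have Q: "bounded_linear Q"
    unfolding Q_def
    by (intro bounded_linear_sub bounded_linear_ident bounded_linear_orth_proj
        subspace_common closed_common)
  define F where "F = (\<lambda>k x. real k powr \<epsilon> *\<^sub>R (T ^^ k) (Q x)) ` {1..}"
  have "bounded_linear f" if "f \<in> F" for f
    using that unfolding F_def
    by (auto intro!: bounded_linear_compose[OF bounded_linear_scaleR_right]
        bounded_linear_compose[OF bounded_linear_T_pow] Q)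
  moreover have "\<exists>C. \<forall>f\<in>F. norm (f x) \<le> C" for x
  proof -
    have "Q x \<in> common\<^sup>\<bottom>"
      unfolding Q_def by (rule orth_proj_residual[OF subspace_common closed_common])
    then obtain D where D: "\<And>k. k \<ge> 1 \<Longrightarrow> norm ((T ^^ k) (Q x)) \<le> D * real k powr (- \<epsilon>)"
      using rate by blast
    have "norm (real k powr \<epsilon> *\<^sub>R (T ^^ k) (Q x)) \<le> D" if k: "k \<ge> 1" for k
      using D[OF k] k by (simp add: powr_minus field_simps)
    then show ?thesis by (auto simp: F_def)
  qed
  ultimately obtain C where C: "C \<ge> 0" "\<And>f x. f \<in> F \<Longrightarrow> norm (f x) \<le> C * norm x"
    using uniform_boundedness_principle[of F] by blast
  have unif: "norm ((T ^^ k) x) \<le> (C * real k powr (- \<epsilon>)) * norm x"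
    if k: "k \<ge> 1" and x: "x \<in> common\<^sup>\<bottom>" for k x
  proof -
    have "orth_proj common x = 0"
      by (rule orth_proj_eqI[OF subspace_common]) (use x subspace_common in \<open>auto simp: subspace_0\<close>)
    then have "norm (real k powr \<epsilon> *\<^sub>R (T ^^ k) x) \<le> C * norm x"
      using C(2)[of "\<lambda>x. real k powr \<epsilon> *\<^sub>R (T ^^ k) (Q x)" x] k by (auto simp: F_def Q_def)
    then show ?thesis using k by (simp add: powr_minus field_simps)
  qed
  have "(\<lambda>k. C * real k powr (- \<epsilon>)) \<longlonglongrightarrow> C * 0"
    using \<epsilon> by (intro tendsto_intros tendsto_neg_powr filterlim_real_sequentially) auto
  then have "eventually (\<lambda>k. C * real k powr (- \<epsilon>) < 1 \<and> k \<ge> 1) sequentially"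
    using order_tendstoD(2)[of _ "0::real" sequentially 1] eventually_ge_at_top[of 1]
    by (intro eventually_conj) auto
  then obtain k where "C * real k powr (- \<epsilon>) < 1" "k \<ge> 1"
    using eventually_happens'[OF sequentially_bot] by blast
  with unif C(1) show ?thesis
    by (intro S_onto_if_power_contracts[of "C * real k powr (- \<epsilon>)" k]) auto
qed

section \<open>The spaces \<open>X\<^sub>p\<close> and \<open>Y\<close>\<close>

lemma X_space_eq: "X_space M m p = common + range (S ^^ p)"
  by (simp add: X_space_def S_def)

lemma range_S_pow_Suc_subset: "range (S ^^ Suc p) \<subseteq> range (S ^^ p)"
  unfolding funpow_Suc_right by auto

lemma range_S_pow_subset_complement:
  assumes "p \<ge> 1"
  shows "range (S ^^ p) \<subseteq> common\<^sup>\<bottom>"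
  using assms by (cases p) (auto simp: S_mem)

text \<open>Adding the summand \<open>M\<close> to a subset of \<open>M\<^sup>\<bottom>\<close> creates no new vectors in \<open>M\<^sup>\<bottom>\<close>; this reduces
  statements on \<open>X\<^sub>p\<close> and \<open>Y\<close> to statements on ranges and on the sum of complements.\<close>

lemma mem_common_plus_iff:
  assumes "R \<subseteq> common\<^sup>\<bottom>" "e \<in> common\<^sup>\<bottom>"
  shows "e \<in> common + R \<longleftrightarrow> e \<in> R"
proof
  assume "e \<in> common + R"
  then obtain a r where ar: "e = a + r" "a \<in> common" "r \<in> R" by (rule set_plus_elim)
  have "e - r \<in> common\<^sup>\<bottom>" using assms ar by (intro subspace_diff subspace_orthogonal_comp) auto
  then have "a = 0" using ar mem_orthogonal_comp_self_eq_0[of a common] by simp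
  with ar show "e \<in> R" by simp
next
  assume "e \<in> R"
  then have "0 + e \<in> common + R" by (intro set_plus_intro subspace_0 subspace_common)
  then show "e \<in> common + R" by simp
qed

lemma X_space_Suc_subset: "X_space M m (Suc p) \<subseteq> X_space M m p"
  unfolding X_space_eq by (intro set_plus_mono2 range_S_pow_Suc_subset order_refl)

lemma X_space_subset_Y_space:
  assumes "p \<ge> 1"
  shows "X_space M m p \<subseteq> Y_space M m"
  using assms
proof (induction p rule: dec_induct)
  case base
  show ?case
    unfolding X_space_eq Y_space_def
    by (intro set_plus_mono2 order_refl) (simp add: range_S_subset_sum_complements)
next
  case (step p)
  then show ?case using X_space_Suc_subset by blast
qed

text \<open>As \<open>I - T\<close> is injective on \<open>M\<^sup>\<bottom>\<close>, equality of two consecutive ranges can be cancelled down to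
  surjectivity of \<open>I - T\<close> on \<open>M\<^sup>\<bottom>\<close>.\<close>

lemma S_onto_if_X_space_Suc_eq:
  assumes p: "p \<ge> 1" and eq: "X_space M m (Suc p) = X_space M m p"
  shows "common\<^sup>\<bottom> \<subseteq> range S"
proof
  fix z assume z: "z \<in> common\<^sup>\<bottom>"
  have pz: "(S ^^ p) z \<in> common\<^sup>\<bottom>" using z by (rule S_pow_mem)
  then have "(S ^^ p) z \<in> X_space M m p"
    unfolding X_space_eq using mem_common_plus_iff range_S_pow_subset_complement[OF p] by blast
  then have "(S ^^ p) z \<in> range (S ^^ Suc p)"
    using mem_common_plus_iff[OF range_S_pow_subset_complement pz, of "Suc p"]
    unfolding eq[symmetric] unfolding X_space_eq by simp
  then obtain x where "(S ^^ p) z = (S ^^ p) (S x)" by (auto simp: funpow_swap1)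
  then have "(S ^^ p) (z - S x) = 0" by (simp add: linear_diff[OF linear_S_pow])
  moreover have "z - S x \<in> common\<^sup>\<bottom>"
    using z S_mem by (intro subspace_diff subspace_orthogonal_comp)
  ultimately have "z - S x = 0" by (rule S_pow_eq_0_imp_eq_0[rotated])
  then show "z \<in> range S" by simp
qed

lemma S_onto_if_X_space_1_eq_Y_space:
  assumes eq: "X_space M m 1 = Y_space M m"
  shows "common\<^sup>\<bottom> \<subseteq> range S"
proof (rule S_onto_if_sum_complements_subset_range_S, rule subsetI)
  fix e assume e: "e \<in> sum_complements M m"
  then have eN: "e \<in> common\<^sup>\<bottom>" using sum_complements_orthogonal by blast
  with e have "e \<in> X_space M m 1"
    unfolding eq Y_space_def using mem_common_plus_iff sum_complements_orthogonal by blast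
  then show "e \<in> range S"
    unfolding X_space_eq using mem_common_plus_iff[OF _ eN] range_S_pow_subset_complement[of 1]
    by simp
qed

lemma S_onto_if_rate_on_X_space:
  assumes p: "p \<ge> 1" and \<epsilon>: "\<epsilon> > 0"
    and rate: "\<And>y. y \<in> X_space M m p \<Longrightarrow>
      (\<lambda>k. norm ((T ^^ k) y - orth_proj common y)) \<in> o(\<lambda>k. real k powr (- real p - \<epsilon>))"
  shows "common\<^sup>\<bottom> \<subseteq> range S"
proof (rule S_onto_if_pointwise_rate[OF \<epsilon>])
  fix x assume x: "x \<in> common\<^sup>\<bottom>"
  let ?y = "(S ^^ p) x"
  have y: "?y \<in> common\<^sup>\<bottom>" using x by (rule S_pow_mem)
  then have "?y \<in> X_space M m p"
    unfolding X_space_eq using mem_common_plus_iff range_S_pow_subset_complement[OF p] by blast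
  moreover have "orth_proj common ?y = 0"
    by (rule orth_proj_eqI[OF subspace_common]) (use y subspace_common in \<open>auto simp: subspace_0\<close>)
  ultimately have "(\<lambda>k. norm ((T ^^ k) ?y)) \<in> o(\<lambda>k. real k powr (- real p - \<epsilon>))"
    using rate[of ?y] by simp
  then have "(\<lambda>k. norm ((T ^^ k) ?y) / real k powr (- real p - \<epsilon>)) \<longlonglongrightarrow> 0"
    by (rule smalloD_tendsto)
  then have "Bseq (\<lambda>k. norm ((T ^^ k) ?y) / real k powr (- real p - \<epsilon>))"
    by (intro convergent_imp_Bseq convergentI)
  then obtain C where "\<And>k. norm (norm ((T ^^ k) ?y) / real k powr (- real p - \<epsilon>)) \<le> C"
    by (auto simp: Bseq_def)
  then have C: "norm ((T ^^ k) ?y) / real k powr (- real p - \<epsilon>) \<le> C" for k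
    using abs_le_D1 by (metis real_norm_def)
  have "norm ((T ^^ k) ?y) \<le> C * real k powr (- real p - \<epsilon>)" if "k \<ge> 1" for k
    using C[of k] that by (simp add: pos_divide_le_eq)
  from rate_of_S_pow_imp_rate[OF x \<epsilon> this]
  show "\<exists>D. \<forall>k\<ge>1. norm ((T ^^ k) x) \<le> D * real k powr (- \<epsilon>)" by blast
qed

end

theorem corollary4p4:
  fixes M :: "nat \<Rightarrow> 'a::{real_inner, complete_space} set" and m :: nat
  assumes "m \<ge> 1"
    and "\<And>i. i \<in> {1..m} \<Longrightarrow> subspace (M i)"
    and "\<And>i. i \<in> {1..m} \<Longrightarrow> closed (M i)"
    and "\<not> closed (sum_complements M m)"
  shows "(\<forall>p\<ge>1. \<forall>\<epsilon>>0.
            \<not> (\<forall>y0 \<in> X_space M m p.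
                 (\<lambda>k. norm ((cyclic_proj M m ^^ k) y0 - orth_proj (common_subspace M m) y0))
                   \<in> o(\<lambda>k. real k powr (- real p - \<epsilon>))))
       \<and> (\<forall>p\<ge>1. X_space M m (Suc p) \<subset> X_space M m p \<and> X_space M m p \<subset> Y_space M m)"
proof -
  interpret closed_subspace_family M m
    by unfold_locales (use assms in auto)
  have not_onto: "\<not> common\<^sup>\<bottom> \<subseteq> range S"
    using sum_complements_closed_if_S_onto assms(4) by blast
  have step: "X_space M m (Suc p) \<subset> X_space M m p" if "p \<ge> 1" for p
    using X_space_Suc_subset S_onto_if_X_space_Suc_eq[OF that] not_onto by blast
  have one: "X_space M m 1 \<subset> Y_space M m"
    using X_space_subset_Y_space[of 1] S_onto_if_X_space_1_eq_Y_space not_onto by blast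
  have "X_space M m p \<subset> Y_space M m" if "p \<ge> 1" for p
  proof (cases "p = 1")
    case False
    then obtain q where q: "p = Suc q" "q \<ge> 1" using \<open>p \<ge> 1\<close> by (cases p) auto
    then show ?thesis using step[OF q(2)] X_space_subset_Y_space[OF q(2)] by blast
  qed (use one in simp)
  moreover have "\<not> (\<forall>y0 \<in> X_space M m p.
      (\<lambda>k. norm ((T ^^ k) y0 - orth_proj common y0)) \<in> o(\<lambda>k. real k powr (- real p - \<epsilon>)))"
    if "p \<ge> 1" "\<epsilon> > 0" for p \<epsilon>
    using S_onto_if_rate_on_X_space[OF that] not_onto by blast
  ultimately show ?thesis using step by blast
qed

end
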